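(* Let $k$ be a non-negative integer and let $G$ be a connected $K_{1,4}$-free graph of order $n$. If $\sigma_{k+3}(G) \ge n-k$, then $G$ has a spanning tree $T$ with $|L(T)|+|B(T)| \le 2k+3$. (In particular, such a $T$ has at most $k$ branch vertices.)
   Context: All graphs are finite and simple. For a tree $T$, a leaf is a vertex of degree one in $T$ and a branch vertex is a vertex of degree at least three in $T$; $L(T)$ and $B(T)$ denote the sets of leaves and of branch vertices of $T$. A graph is $K_{1,4}$-free if it contains no induced subgraph isomorphic to $K_{1,4}$. For a positive integer $p$, $\sigma_p(G)=+\infty$ if the independence number of $G$ is less than $p$, and otherwise $\sigma_p(G)$ is the minimum of $\sum_{i=1}^p d_G(v_i)$ over all independent sets $\{v_1,\dots,v_p\}$ of $G$ of size $p$. *)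

theory Defs
  imports Main "HOL-Library.Extended_Nat"
begin

definition simple_graph :: "'a set \<Rightarrow> 'a set set \<Rightarrow> bool" where
  "simple_graph V Ed \<longleftrightarrow> finite V \<and>
     (\<forall>e\<in>Ed. \<exists>u v. u \<noteq> v \<and> u \<in> V \<and> v \<in> V \<and> e = {u, v})"

definition adj :: "'a set set \<Rightarrow> 'a \<Rightarrow> 'a \<Rightarrow> bool" where
  "adj Ed u v \<longleftrightarrow> u \<noteq> v \<and> {u, v} \<in> Ed"

definition degree :: "'a set set \<Rightarrow> 'a \<Rightarrow> nat" where
  "degree Ed v = card {u. adj Ed v u}"

definition connected_graph :: "'a set \<Rightarrow> 'a set set \<Rightarrow> bool" where
  "connected_graph V Ed \<longleftrightarrow> V \<noteq> {} \<and> (\<forall>u\<in>V. \<forall>v\<in>V. (adj Ed)\<^sup>*\<^sup>* u v)"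

definition is_cycle :: "'a set set \<Rightarrow> 'a list \<Rightarrow> bool" where
  "is_cycle Ed cs \<longleftrightarrow> length cs \<ge> 3 \<and> distinct cs \<and>
     (\<forall>i. Suc i < length cs \<longrightarrow> adj Ed (cs ! i) (cs ! Suc i)) \<and>
     adj Ed (last cs) (hd cs)"

definition acyclic_graph :: "'a set set \<Rightarrow> bool" where
  "acyclic_graph Ed \<longleftrightarrow> \<not> (\<exists>cs. is_cycle Ed cs)"

definition is_tree :: "'a set \<Rightarrow> 'a set set \<Rightarrow> bool" where
  "is_tree V Ed \<longleftrightarrow> simple_graph V Ed \<and> connected_graph V Ed \<and> acyclic_graph Ed"

definition spanning_tree :: "'a set \<Rightarrow> 'a set set \<Rightarrow> 'a set set \<Rightarrow> bool" where
  "spanning_tree V Ed T \<longleftrightarrow> T \<subseteq> Ed \<and> is_tree V T"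

definition leaves :: "'a set \<Rightarrow> 'a set set \<Rightarrow> 'a set" where
  "leaves V T = {v\<in>V. degree T v = 1}"

definition branch_vertices :: "'a set \<Rightarrow> 'a set set \<Rightarrow> 'a set" where
  "branch_vertices V T = {v\<in>V. degree T v \<ge> 3}"

definition independent_set :: "'a set \<Rightarrow> 'a set set \<Rightarrow> 'a set \<Rightarrow> bool" where
  "independent_set V Ed S \<longleftrightarrow> S \<subseteq> V \<and> (\<forall>u\<in>S. \<forall>v\<in>S. \<not> adj Ed u v)"

definition K14_free :: "'a set \<Rightarrow> 'a set set \<Rightarrow> bool" where
  "K14_free V Ed \<longleftrightarrow> \<not> (\<exists>c\<in>V. \<exists>S. card S = 4 \<and> independent_set V Ed S \<and>
                                    (\<forall>x\<in>S. adj Ed c x))"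

text \<open>sigma_p(G): minimum degree sum over independent sets of size p; infinity
  (top of enat, the Inf of the empty set) if there is no such set.\<close>

definition sigma :: "'a set \<Rightarrow> 'a set set \<Rightarrow> nat \<Rightarrow> enat" where
  "sigma V Ed p = (INF S \<in> {S. independent_set V Ed S \<and> card S = p}.
                      enat (\<Sum>v\<in>S. degree Ed v))"

end

theory Submission
  imports Defs
begin

text \<open>
  Take a spanning tree \<open>F\<close> with as few leaves as possible, a branch vertex \<open>r\<close> of \<open>F\<close> as root, and,
  subject to this, push the branching away from the root: maximise the sum of
  \<open>(deg b - 2) dist(r, b)\<close> over the branch vertices \<open>b\<close>. For a leaf \<open>v\<close> and a neighbour \<open>y\<close> of \<open>v\<close> in
  the graph let \<open>p v y\<close> be the neighbour of \<open>y\<close> in \<open>F\<close> in the direction of \<open>v\<close>. Exchanging the edge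
  \<open>y (p v y)\<close> for \<open>v y\<close> shows that \<open>p v y\<close>, if different from \<open>v\<close>, has degree two and no leaf neighbour other than \<open>v\<close>;
  \<open>K\<^sub>1\<^sub>,\<^sub>4\<close>-freeness shows that \<open>p v y = p w y\<close> is impossible for distinct leaves \<open>v\<close>, \<open>w\<close>
  adjacent to \<open>y\<close>; and the choice of \<open>F\<close> shows that a leaf is adjacent to no branch vertex below
  which it does not lie. Hence sending \<open>(v, y)\<close> to \<open>p v y\<close> if \<open>v\<close> lies below \<open>y\<close>, and to \<open>y\<close>
  otherwise, is injective into the non-branch vertices, so the degree sum of the leaves is at most
  \<open>card V - |B(F)|\<close>. As \<open>|B(F)| + 2 \<le> |L(F)|\<close>, a tree violating the bound has at least \<open>k + 3\<close> leaves,
  and any \<open>k + 3\<close> of them contradict the hypothesis.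
\<close>

section \<open>Reachability, directions and edge exchange in arbitrary edge sets\<close>

abbreviation reach :: "'a set set \<Rightarrow> 'a \<Rightarrow> 'a \<Rightarrow> bool" where
  "reach F \<equiv> (adj F)\<^sup>*\<^sup>*"

text \<open>Vertex deletion in terms of edges alone: \<open>y\<close> stays as an isolated vertex,
  so no vertex set has to be carried along.\<close>

definition avoid :: "'a set set \<Rightarrow> 'a \<Rightarrow> 'a set set" where
  "avoid F y = {e \<in> F. y \<notin> e}"

text \<open>\<open>toward F u y x\<close>: the neighbour \<open>x\<close> of \<open>y\<close> is the first step from \<open>y\<close> in the direction of \<open>u\<close>.\<close>

definition toward :: "'a set set \<Rightarrow> 'a \<Rightarrow> 'a \<Rightarrow> 'a \<Rightarrow> bool" where
  "toward F u y x \<longleftrightarrow> adj F y x \<and> reach (avoid F y) x u"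

definition dist_in :: "'a set set \<Rightarrow> 'a \<Rightarrow> 'a \<Rightarrow> nat" where
  "dist_in F r u = (LEAST m. (adj F ^^ m) r u)"

definition swap_edge :: "'a set set \<Rightarrow> 'a \<Rightarrow> 'a \<Rightarrow> 'a \<Rightarrow> 'a \<Rightarrow> 'a set set" where
  "swap_edge F x y a b = insert {a, b} (F - {{x, y}})"

lemma adj_commute: "adj F u v \<longleftrightarrow> adj F v u"
  by (auto simp: adj_def insert_commute)

lemma adj_sym: "adj F u v \<Longrightarrow> adj F v u"
  by (simp add: adj_commute)

lemma adj_irrefl [simp]: "\<not> adj F u u"
  by (simp add: adj_def)

lemma adj_mono: "F \<subseteq> F' \<Longrightarrow> adj F u v \<Longrightarrow> adj F' u v"
  by (auto simp: adj_def)

lemma reach_mono: "F \<subseteq> F' \<Longrightarrow> reach F u v \<Longrightarrow> reach F' u v"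
  by (metis adj_mono mono_rtranclp)

lemma reach_sym: "reach F u v \<Longrightarrow> reach F v u"
  by (metis adj_commute sympI symp_rtranclp sympD)

lemma adj_avoid: "adj (avoid F y) u v \<longleftrightarrow> adj F u v \<and> u \<noteq> y \<and> v \<noteq> y"
  by (auto simp: adj_def avoid_def)

lemma avoid_subset: "avoid F y \<subseteq> F - {{x, y}}"
  by (auto simp: avoid_def)

lemma reach_avoid_neq: "reach (avoid F y) x u \<Longrightarrow> x \<noteq> y \<Longrightarrow> u \<noteq> y"
  by (induction rule: rtranclp_induct) (auto simp: adj_avoid)

lemma toward_adj: "toward F u y x \<Longrightarrow> adj F y x"
  by (simp add: toward_def)

lemma toward_self: "adj F y x \<Longrightarrow> toward F x y x"
  by (simp add: toward_def)

lemma toward_neq: "toward F u y x \<Longrightarrow> u \<noteq> y"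
  unfolding toward_def by (metis adj_irrefl reach_avoid_neq)

lemma toward_transfer:
  assumes "toward F u y x" "adj F' y x" "avoid F y \<subseteq> F'"
  shows "toward F' u y x"
proof -
  have "avoid F y \<subseteq> avoid F' y" using assms(3) by (auto simp: avoid_def)
  then show ?thesis using assms by (auto simp: toward_def intro: reach_mono)
qed

lemma toward_edge:
  assumes "adj F y x" "adj F x u" "u \<noteq> y"
  shows "toward F u y x"
  using assms by (auto simp: toward_def adj_avoid intro!: r_into_rtranclp)

lemma adj_swap_edge:
  assumes "a \<noteq> b"
  shows "adj (swap_edge F x y a b) u v \<longleftrightarrow> {u, v} = {a, b} \<or> adj F u v \<and> {u, v} \<noteq> {x, y}"
  using assms by (auto simp: adj_def swap_edge_def doubleton_eq_iff)

lemma degree_insert: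
  assumes "finite {v. adj F u v}" "a \<noteq> b" "\<not> adj F a b"
  shows "degree (insert {a, b} F) u = degree F u + (if u = a \<or> u = b then 1 else 0)"
proof -
  have "{v. adj (insert {a, b} F) u v} =
      (if u = a then insert b {v. adj F u v} else if u = b then insert a {v. adj F u v} else {v. adj F u v})"
    using assms(2) by (auto simp: adj_def doubleton_eq_iff)
  then show ?thesis using assms adj_commute[of F a b] by (auto simp: degree_def)
qed

lemma degree_remove:
  assumes "finite {v. adj F u v}" "adj F a b"
  shows "degree (F - {{a, b}}) u = degree F u - (if u = a \<or> u = b then 1 else 0)"
proof -
  have "a \<noteq> b" using assms by auto
  then have "{v. adj (F - {{a, b}}) u v} =
      (if u = a then {v. adj F u v} - {b} else if u = b then {v. adj F u v} - {a} else {v. adj F u v})"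
    by (auto simp: adj_def doubleton_eq_iff)
  then show ?thesis using assms adj_commute[of F a b] by (auto simp: degree_def)
qed

lemma degree_swap_edge:
  assumes "finite {v. adj F u v}" "adj F x y" "a \<noteq> b" "\<not> adj F a b"
  shows "degree (swap_edge F x y a b) u =
    (degree F u - (if u = x \<or> u = y then 1 else 0)) + (if u = a \<or> u = b then 1 else 0)"
proof -
  have "finite {v. adj (F - {{x, y}}) u v}"
    by (rule finite_subset[OF _ assms(1)]) (auto simp: adj_def)
  moreover have "\<not> adj (F - {{x, y}}) a b" using assms by (auto simp: adj_def)
  ultimately show ?thesis
    unfolding swap_edge_def using degree_insert assms(3) degree_remove[OF assms(1,2)] by metis
qed

lemma degree_one_unique:
  assumes "degree F v = 1" "adj F v a" "adj F v b"
  shows "a = b"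
  using assms unfolding degree_def by (metis card_1_singletonE mem_Collect_eq singletonD)

text \<open>The only neighbour of the leaf \<open>v\<close> is \<open>y\<close>, so without
  \<open>y\<close> nothing but \<open>v\<close> itself can be reached from \<open>v\<close>.\<close>

lemma not_toward_leaf:
  assumes "degree F v = 1" "u \<noteq> v"
  shows "\<not> toward F u y v"
proof
  assume t: "toward F u y v"
  then have "reach (avoid F y) v u" by (simp add: toward_def)
  then show False
  proof (cases rule: converse_rtranclpE)
    case (step z)
    then have "z = y"
      using degree_one_unique[OF assms(1)] toward_adj[OF t] by (auto simp: adj_avoid adj_commute)
    then show False using step by (simp add: adj_avoid)
  qed (use assms in auto)
qed

section \<open>Distances from a root\<close>

lemma dist_in_le: "(adj F ^^ m) r u \<Longrightarrow> dist_in F r u \<le> m"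
  unfolding dist_in_def by (rule Least_le)

lemma dist_in_relpow: "reach F r u \<Longrightarrow> (adj F ^^ dist_in F r u) r u"
  unfolding dist_in_def by (metis LeastI rtranclp_imp_relpowp)

lemma dist_in_self [simp]: "dist_in F r r = 0"
  using dist_in_le[of 0 F r r] by simp

lemma dist_in_adj: "reach F r u \<Longrightarrow> adj F u v \<Longrightarrow> dist_in F r v \<le> Suc (dist_in F r u)"
  by (rule dist_in_le) (metis dist_in_relpow relpowp_Suc_I)

text \<open>Bounds distances from below without describing paths: a function that vanishes at the
  root and grows by at most one along each edge stays below the distance. Later it compares
  distances before and after an exchange.\<close>

lemma dist_in_greatest:
  assumes "reach F r u" "g r = 0" "\<And>x y. adj F x y \<Longrightarrow> g y \<le> Suc (g x)"
  shows "g u \<le> dist_in F r u"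
proof -
  have "(adj F ^^ m) r z \<Longrightarrow> g z \<le> m" for m z
  proof (induction m arbitrary: z)
    case (Suc m)
    then obtain z' where "(adj F ^^ m) r z'" "adj F z' z" by auto
    then show ?case using Suc.IH assms(3)[of z' z] by fastforce
  qed (use assms in auto)
  then show ?thesis using dist_in_relpow[OF assms(1)] by blast
qed

lemma dist_in_pred:
  assumes "reach F r u" "u \<noteq> r"
  shows "\<exists>x. adj F x u \<and> reach F r x \<and> dist_in F r u = Suc (dist_in F r x)"
proof -
  obtain m where m: "dist_in F r u = Suc m"
    using dist_in_relpow[OF assms(1)] assms(2) by (cases "dist_in F r u") auto
  then obtain x where x: "(adj F ^^ m) r x" "adj F x u"
    using dist_in_relpow[OF assms(1)] by auto
  have rx: "reach F r x" using x(1) by (meson relpowp_imp_rtranclp)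
  have "dist_in F r x \<le> m" using x by (simp add: dist_in_le)
  moreover have "Suc m \<le> Suc (dist_in F r x)" using m dist_in_adj[OF rx x(2)] by simp
  ultimately show ?thesis using m x rx by auto
qed

section \<open>Spanning trees as connected edge sets of the right size\<close>

locale finite_graph =
  fixes V :: "'a set" and Ed :: "'a set set"
  assumes simple: "simple_graph V Ed"
begin

text \<open>Counting edges replaces acyclicity: an edge exchange then only has to preserve connectedness.\<close>

definition stree :: "'a set set \<Rightarrow> bool" where
  "stree F \<longleftrightarrow> F \<subseteq> Ed \<and> connected_graph V F \<and> Suc (card F) = card V"

definition min_leaf_tree :: "'a set set \<Rightarrow> bool" where
  "min_leaf_tree F \<longleftrightarrow> stree F \<and> (\<forall>F'. stree F' \<longrightarrow> card (leaves V F) \<le> card (leaves V F'))"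

lemma finite_V: "finite V"
  using simple by (simp add: simple_graph_def)

lemma edge_in_V:
  assumes "F \<subseteq> Ed" "adj F u v"
  shows "u \<in> V \<and> v \<in> V"
proof -
  have "{u, v} \<in> Ed" using assms by (auto simp: adj_def)
  then obtain a b where "a \<in> V" "b \<in> V" "{u, v} = {a, b}"
    using simple unfolding simple_graph_def by metis
  then show ?thesis by (auto simp: doubleton_eq_iff)
qed

lemma finite_Ed: "finite Ed"
proof (rule finite_subset)
  show "Ed \<subseteq> Pow V"
  proof
    fix e assume "e \<in> Ed"
    then obtain a b where "a \<in> V" "b \<in> V" "e = {a, b}"
      using simple unfolding simple_graph_def by metis
    then show "e \<in> Pow V" by simp
  qed
qed (simp add: finite_V)

lemma finite_nbrs: "F \<subseteq> Ed \<Longrightarrow> finite {v. adj F u v}"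
  by (rule finite_subset[OF _ finite_V]) (use edge_in_V in auto)

lemma finite_leaves: "finite (leaves V F)"
  using finite_V by (simp add: leaves_def)

lemma connectedD: "connected_graph V F \<Longrightarrow> u \<in> V \<Longrightarrow> v \<in> V \<Longrightarrow> reach F u v"
  by (simp add: connected_graph_def)

lemma connected_transfer:
  assumes "connected_graph V F" "\<And>x y. adj F x y \<Longrightarrow> reach F' x y"
  shows "connected_graph V F'"
proof -
  have "reach F x y \<Longrightarrow> reach F' x y" for x y
    by (induction rule: rtranclp_induct) (use assms(2) in \<open>auto intro: rtranclp_trans\<close>)
  then show ?thesis using assms(1) by (simp add: connected_graph_def)
qed

text \<open>Each vertex other than \<open>r\<close> is charged to an edge leading one step closer to
  \<open>r\<close>; the edge determines its farther end, so the charging is injective.\<close>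

lemma connected_card:
  assumes "F \<subseteq> Ed" "connected_graph V F"
  shows "card V \<le> Suc (card F)"
proof -
  obtain r where r: "r \<in> V" using assms by (auto simp: connected_graph_def)
  have "\<forall>u\<in>V - {r}. \<exists>x. adj F x u \<and> dist_in F r u = Suc (dist_in F r x)"
    using dist_in_pred connectedD[OF assms(2) r] by (metis DiffE singletonI)
  then obtain f where f: "\<And>u. u \<in> V - {r} \<Longrightarrow> adj F (f u) u \<and> dist_in F r u = Suc (dist_in F r (f u))"
    by metis
  have "inj_on (\<lambda>u. {u, f u}) (V - {r})"
    by (rule inj_onI) (metis f doubleton_eq_iff n_not_Suc_n Suc_n_not_le_n nat_le_linear le_SucI)
  moreover have "(\<lambda>u. {u, f u}) ` (V - {r}) \<subseteq> F" using f by (auto simp: adj_def insert_commute)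
  ultimately have "card (V - {r}) \<le> card F"
    using card_inj_on_le finite_subset[OF assms(1) finite_Ed] by blast
  then show ?thesis using r finite_V by (simp add: card_Diff_singleton)
qed

text \<open>Choosing for each vertex one edge towards \<open>r\<close> yields a breadth-first
  tree.\<close>

lemma stree_exists:
  assumes "connected_graph V Ed"
  shows "\<exists>F. stree F"
proof -
  obtain r where r: "r \<in> V" using assms by (auto simp: connected_graph_def)
  have "\<forall>u\<in>V - {r}. \<exists>x. adj Ed x u \<and> dist_in Ed r u = Suc (dist_in Ed r x)"
    using dist_in_pred connectedD[OF assms r] by (metis DiffE singletonI)
  then obtain f where f: "\<And>u. u \<in> V - {r} \<Longrightarrow> adj Ed (f u) u \<and> dist_in Ed r u = Suc (dist_in Ed r (f u))"
    by metis
  define F where "F = (\<lambda>u. {u, f u}) ` (V - {r})"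
  have sub: "F \<subseteq> Ed" using f by (auto simp: F_def adj_def insert_commute)
  have "\<forall>u\<in>V. dist_in Ed r u = m \<longrightarrow> reach F u r" for m
  proof (induction m)
    case 0
    then show ?case using f by (metis Diff_iff Zero_not_Suc rtranclp.rtrancl_refl singletonD)
  next
    case (Suc m)
    show ?case
    proof (intro ballI impI)
      fix u assume u: "u \<in> V" "dist_in Ed r u = Suc m"
      then have "u \<noteq> r" by auto
      then have fu: "adj Ed (f u) u" "dist_in Ed r (f u) = m" using f u by auto
      then have "reach F (f u) r" using Suc edge_in_V[of Ed] by auto
      moreover have "adj F u (f u)" using u \<open>u \<noteq> r\<close> fu by (auto simp: F_def adj_def)
      ultimately show "reach F u r" by auto
    qed
  qed
  then have "connected_graph V F"
    using r unfolding connected_graph_def by (metis empty_iff reach_sym rtranclp_trans)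
  moreover from this have "card V \<le> Suc (card F)" by (rule connected_card[OF sub])
  moreover have "card F \<le> card (V - {r})" unfolding F_def by (rule card_image_le) (simp add: finite_V)
  moreover have "Suc (card (V - {r})) = card V" using r finite_V by (intro card_Suc_Diff1)
  ultimately show ?thesis using sub by (auto simp: stree_def)
qed

lemma streeD:
  assumes "stree F"
  shows stree_subset: "F \<subseteq> Ed" and stree_connected: "connected_graph V F"
    and stree_card: "Suc (card F) = card V"
  using assms by (auto simp: stree_def)

lemma stree_V: "stree F \<Longrightarrow> adj F u v \<Longrightarrow> u \<in> V \<and> v \<in> V"
  using edge_in_V stree_subset by blast

text \<open>Otherwise the edge could be deleted without losing connectedness, leaving fewer edges
  than \<open>connected_card\<close> permits.\<close>

lemma stree_bridge:
  assumes "stree F" "adj F x y"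
  shows "\<not> reach (F - {{x, y}}) x y"
proof
  assume r: "reach (F - {{x, y}}) x y"
  have "connected_graph V (F - {{x, y}})"
  proof (rule connected_transfer[OF stree_connected[OF assms(1)]])
    fix a b assume "adj F a b"
    then show "reach (F - {{x, y}}) a b"
    proof (cases "{a, b} = {x, y}")
      case True
      then show ?thesis using r reach_sym[OF r] by (auto simp: doubleton_eq_iff)
    qed (auto simp: adj_def intro!: r_into_rtranclp)
  qed
  moreover have "F - {{x, y}} \<subseteq> Ed" using stree_subset assms(1) by blast
  ultimately have "card V \<le> Suc (card (F - {{x, y}}))" by (rule connected_card[rotated])
  moreover have "finite F" using finite_subset[OF stree_subset[OF assms(1)] finite_Ed] .
  then have "Suc (card (F - {{x, y}})) = card F"
    using assms(2) card_Suc_Diff1 by (fastforce simp: adj_def)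
  ultimately show False using stree_card[OF assms(1)] by simp
qed

text \<open>The closing edge of a cycle is bypassed by the rest of the cycle, so it would not be a
  bridge.\<close>

lemma stree_is_tree:
  assumes "stree F"
  shows "spanning_tree V Ed F"
proof -
  have "simple_graph V F"
    using simple stree_subset[OF assms] unfolding simple_graph_def by blast
  moreover have "\<not> is_cycle F cs" for cs
  proof
    assume c: "is_cycle F cs"
    define l where "l = length cs"
    define e where "e = {cs ! (l - 1), cs ! 0}"
    have l: "l \<ge> 3" "distinct cs" using c by (auto simp: is_cycle_def l_def)
    have "cs \<noteq> []" using l l_def by auto
    then have hl: "hd cs = cs ! 0" "last cs = cs ! (l - 1)" by (auto simp: hd_conv_nth last_conv_nth l_def)
    have "i < l \<longrightarrow> reach (F - {e}) (cs ! 0) (cs ! i)" for i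
    proof (induction i)
      case (Suc i)
      show ?case
      proof
        assume i: "Suc i < l"
        then have "adj F (cs ! i) (cs ! Suc i)" using c by (auto simp: is_cycle_def l_def)
        \<comment> \<open>The length of at least three matters here: a consecutive pair equal to the
          closing edge would force \<open>l = 2\<close>.\<close>
        moreover have "{cs ! i, cs ! Suc i} \<noteq> e"
        proof
          have "cs ! i \<noteq> cs ! (l - 1)" using i l nth_eq_iff_index_eq[of cs i "l - 1"] by (simp add: l_def)
          moreover assume "{cs ! i, cs ! Suc i} = e"
          ultimately have "cs ! i = cs ! 0" "cs ! Suc i = cs ! (l - 1)" by (auto simp: e_def doubleton_eq_iff)
          moreover have "0 < l" using i by simp
          ultimately have "i = 0" "Suc i = l - 1"
            using i l nth_eq_iff_index_eq[of cs i 0] nth_eq_iff_index_eq[of cs "Suc i" "l - 1"]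
            by (simp_all add: l_def)
          then show False using l by simp
        qed
        ultimately have "adj (F - {e}) (cs ! i) (cs ! Suc i)" by (auto simp: adj_def)
        then show "reach (F - {e}) (cs ! 0) (cs ! Suc i)" using Suc i by (auto intro: rtranclp.rtrancl_into_rtrancl)
      qed
    qed simp
    then have "reach (F - {e}) (cs ! 0) (cs ! (l - 1))" using l by auto
    then have "reach (F - {e}) (cs ! (l - 1)) (cs ! 0)" by (rule reach_sym)
    moreover have "adj F (cs ! (l - 1)) (cs ! 0)" using c hl by (auto simp: is_cycle_def)
    ultimately show False using stree_bridge[OF assms] e_def by metis
  qed
  ultimately show ?thesis
    using stree_subset[OF assms] stree_connected[OF assms]
    by (auto simp: spanning_tree_def is_tree_def acyclic_graph_def)
qed

section \<open>Directions and sides of edges in a tree\<close>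

lemma toward_in_V:
  assumes "stree F" "toward F u y x"
  shows "u \<in> V"
proof -
  have "reach (avoid F y) x u" using assms(2) by (simp add: toward_def)
  then show ?thesis
    using stree_V[OF assms(1)] toward_adj[OF assms(2)] by (cases rule: rtranclp.cases) (auto simp: adj_avoid)
qed

text \<open>Two different first steps would give a detour from \<open>x\<close> through
  \<open>u\<close> and \<open>x'\<close> to \<open>y\<close> that bypasses the bridge between
  \<open>x\<close> and \<open>y\<close>.\<close>

lemma toward_unique:
  assumes "stree F" "toward F u y x" "toward F u y x'"
  shows "x = x'"
proof (rule ccontr)
  assume neq: "x \<noteq> x'"
  have a: "adj F y x" "adj F y x'" using assms by (auto simp: toward_def)
  have "reach (avoid F y) x u" "reach (avoid F y) u x'"
    using assms by (auto simp: toward_def intro: reach_sym)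
  then have "reach (avoid F y) x x'" by (rule rtranclp_trans)
  then have "reach (F - {{x, y}}) x x'" using reach_mono avoid_subset by metis
  moreover have "adj (F - {{x, y}}) x' y" using a neq by (auto simp: adj_def doubleton_eq_iff insert_commute)
  ultimately have "reach (F - {{x, y}}) x y" by (rule rtranclp.rtrancl_into_rtrancl)
  then show False using stree_bridge[OF assms(1)] a adj_commute by metis
qed

lemma toward_exists:
  assumes "stree F" "u \<in> V" "y \<in> V" "u \<noteq> y"
  shows "\<exists>x. toward F u y x"
proof -
  \<comment> \<open>Invariant of a walk starting at \<open>u\<close>: either it has stayed clear of
    \<open>y\<close>, or a neighbour of \<open>y\<close> has already been reached without using
    \<open>y\<close>.\<close>
  have "reach F u z \<Longrightarrow> reach (avoid F y) u z \<and> z \<noteq> y \<or> (\<exists>x. adj F y x \<and> reach (avoid F y) u x)" for z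
  proof (induction rule: rtranclp_induct)
    case (step z z')
    then show ?case using adj_commute[of F z z'] by (cases "z' = y") (auto simp: adj_avoid intro: rtranclp.rtrancl_into_rtrancl)
  qed (use assms in auto)
  from this[of y] show ?thesis
    using connectedD[OF stree_connected] assms by (auto simp: toward_def intro: reach_sym)
qed

lemma toward_opposite:
  assumes "stree F" "toward F u y x"
  shows "\<not> toward F u x y"
proof
  assume "toward F u x y"
  then have "reach (F - {{x, y}}) u y"
    by (metis toward_def reach_sym reach_mono avoid_subset insert_commute)
  moreover have "reach (F - {{x, y}}) x u"
    using assms(2) by (metis toward_def reach_mono avoid_subset)
  ultimately have "reach (F - {{x, y}}) x y" by auto
  then show False using stree_bridge[OF assms(1)] assms(2) by (simp add: toward_def adj_commute)
qed

text \<open>The walk from \<open>x\<close> to \<open>u\<close> avoiding \<open>y\<close> also misses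
  \<open>y'\<close>, since otherwise \<open>x\<close> and \<open>y'\<close> would be two directions
  from \<open>y\<close> to \<open>y'\<close>.\<close>

lemma toward_step:
  assumes "stree F" "toward F u y x" "adj F y y'" "y' \<noteq> x"
  shows "toward F u y' y"
proof -
  have ne: "reach (avoid F y) x z \<Longrightarrow> z \<noteq> y'" for z
    using toward_unique[OF assms(1)] toward_self[OF assms(3)] assms(4) toward_adj[OF assms(2)]
    by (metis toward_def)
  have "reach (avoid F y) x z \<Longrightarrow> reach (avoid F y') x z" for z
  proof (induction rule: rtranclp_induct)
    case (step z z')
    then have "z \<noteq> y'" "z' \<noteq> y'" using ne by (auto intro: rtranclp.rtrancl_into_rtrancl)
    then have "adj (avoid F y') z z'" using step by (simp add: adj_avoid)
    then show ?case using step by (auto intro: rtranclp.rtrancl_into_rtrancl)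
  qed simp
  moreover have "adj (avoid F y') y x"
    using assms toward_adj[OF assms(2)] by (auto simp: adj_avoid)
  ultimately have "reach (avoid F y') y u"
    using assms(2) by (auto simp: toward_def intro: converse_rtranclp_into_rtranclp)
  then show ?thesis using assms(3) by (simp add: toward_def adj_commute)
qed

text \<open>\<open>toward F a q b\<close> places \<open>a\<close> on the \<open>b\<close>-side of
  the edge between \<open>b\<close> and \<open>q\<close>; this edge is the only one leaving that
  side.\<close>

lemma side_closed:
  assumes "stree F" "toward F a q b" "adj F a c" "{a, c} \<noteq> {b, q}"
  shows "toward F c q b"
proof (cases "c = q")
  case True
  then have "toward F a q a" using assms by (simp add: toward_self adj_commute)
  then have "a = b" using toward_unique assms by blast
  then show ?thesis using True assms by auto
next
  case False
  then show ?thesis using assms toward_neq[OF assms(2)]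
    by (auto simp: toward_def adj_avoid intro: rtranclp.rtrancl_into_rtrancl)
qed

lemma dist_in_toward:
  assumes "stree F" "r \<in> V" "toward F r c b"
  shows "dist_in F r c = Suc (dist_in F r b)"
proof -
  let ?h = "dist_in F r"
  have cb: "adj F b c" "b \<in> V" "c \<in> V"
    using stree_V[OF assms(1)] toward_adj[OF assms(3)] adj_sym by auto
  have rch: "x \<in> V \<Longrightarrow> reach F r x" for x
    using connectedD stree_connected assms by blast
  have lip: "?h y \<le> Suc (?h x)" if "adj F x y" for x y
    using dist_in_adj[OF rch that] stree_V[OF assms(1) that] by blast
  \<comment> \<open>Distances on the side of \<open>c\<close> are raised to at least one more than
    that of \<open>b\<close>. Only the edge between \<open>b\<close> and \<open>c\<close> enters
    this side, so \<open>g\<close> still grows by at most one per edge.\<close>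
  define g where "g u = (if toward F u b c then max (?h u) (Suc (?h b)) else ?h u)" for u
  have "g c \<le> ?h c"
  proof (rule dist_in_greatest[OF rch[OF cb(3)]])
    show "g r = 0" using toward_opposite[OF assms(1,3)] by (simp add: g_def)
    fix x y assume a: "adj F x y"
    show "g y \<le> Suc (g x)"
    proof (cases "{x, y} = {c, b}")
      case True
      then show ?thesis using lip[OF a] lip[OF cb(1)] toward_neq[of F b b c] 
        by (auto simp: g_def doubleton_eq_iff)
    next
      case False
      moreover from this have "{y, x} \<noteq> {c, b}" by (simp add: insert_commute)
      ultimately have "toward F x b c \<longleftrightarrow> toward F y b c"
        using side_closed[OF assms(1) _ a] side_closed[OF assms(1) _ adj_sym[OF a]] by blast
      then show ?thesis using lip[OF a] by (auto simp: g_def)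
    qed
  qed
  moreover have "toward F c b c" using cb by (simp add: toward_self)
  ultimately show ?thesis using lip[OF cb(1)] by (auto simp: g_def)
qed

lemma stree_no_triangle:
  assumes "stree F" "adj F b x" "adj F b y" "x \<noteq> y"
  shows "\<not> adj F x y"
  by (metis assms toward_edge toward_self toward_unique adj_irrefl)

section \<open>Edge exchanges in a tree\<close>

lemma stree_exchange:
  assumes "stree F" "toward F v y x" "toward F w x y" "adj Ed v w" "\<not> adj F v w"
  shows "stree (swap_edge F x y v w)"
proof -
  let ?F = "swap_edge F x y v w"
  have F: "F \<subseteq> Ed" "finite F" using stree_subset[OF assms(1)] finite_Ed finite_subset by auto
  have sub: "F - {{x, y}} \<subseteq> ?F" by (auto simp: swap_edge_def)
  \<comment> \<open>Deleting the edge leaves \<open>v\<close> joined to \<open>x\<close> and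
    \<open>w\<close> joined to \<open>y\<close>, so the new edge reconnects \<open>x\<close> with
    \<open>y\<close>.\<close>
  have "reach ?F x v" "reach ?F y w"
    using assms(2,3) unfolding toward_def 
    by (metis sub avoid_subset reach_mono subset_trans insert_commute)+
  moreover have "adj ?F v w" using assms(4) by (auto simp: swap_edge_def adj_def)
  ultimately have xy: "reach ?F x y" by (meson reach_sym rtranclp.rtrancl_into_rtrancl rtranclp_trans)
  have "connected_graph V ?F"
  proof (rule connected_transfer[OF stree_connected[OF assms(1)]])
    fix a b assume "adj F a b"
    then show "reach ?F a b"
    proof (cases "{a, b} = {x, y}")
      case True
      then show ?thesis using xy reach_sym[OF xy] by (auto simp: doubleton_eq_iff)
    qed (auto simp: adj_def swap_edge_def intro!: r_into_rtranclp)
  qed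
  moreover have "?F \<subseteq> Ed" using F assms(4) by (auto simp: swap_edge_def adj_def)
  moreover have "{x, y} \<in> F" using toward_adj[OF assms(3)] by (simp add: adj_def)
  then have "Suc (card (F - {{x, y}})) = card F" using F card_Suc_Diff1 by fastforce
  then have "card ?F = card F"
    using assms(4,5) F by (auto simp: swap_edge_def adj_def)
  ultimately show ?thesis using assms(1) by (simp add: stree_def)
qed

lemma stree_reattach:
  assumes "stree F" "toward F v y x" "adj Ed v y" "\<not> adj F v y"
  shows "stree (swap_edge F x y v y)"
  using stree_exchange[OF assms(1,2) _ assms(3,4)] toward_self toward_adj[OF assms(2)] adj_commute by metis

lemma stree_degree_swap:
  assumes "stree F" "adj F x y" "adj Ed a b" "\<not> adj F a b"
  shows "degree (swap_edge F x y a b) u =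
    (degree F u - (if u = x \<or> u = y then 1 else 0)) + (if u = a \<or> u = b then 1 else 0)"
  using assms adj_irrefl by (intro degree_swap_edge finite_nbrs[OF stree_subset]) auto

lemma degree_ge_card:
  assumes "stree F" "\<And>x. x \<in> S \<Longrightarrow> adj F y x"
  shows "card S \<le> degree F y"
  unfolding degree_def using assms finite_nbrs[OF stree_subset[OF assms(1)]] by (intro card_mono) auto

lemma degree_adj: "stree F \<Longrightarrow> adj F y x \<Longrightarrow> degree F y \<ge> 1"
  using degree_ge_card[of F "{x}" y] by auto

section \<open>Trees with the fewest leaves\<close>

lemma min_leaf_treeD: "min_leaf_tree F \<Longrightarrow> stree F"
  by (simp add: min_leaf_tree_def)

lemma min_leaf_le: "min_leaf_tree F \<Longrightarrow> stree F' \<Longrightarrow> card (leaves V F) \<le> card (leaves V F')"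
  by (simp add: min_leaf_tree_def)

lemma min_leaf_treeI:
  "min_leaf_tree F \<Longrightarrow> stree F' \<Longrightarrow> card (leaves V F') \<le> card (leaves V F) \<Longrightarrow> min_leaf_tree F'"
  by (fastforce simp: min_leaf_tree_def)

lemma min_leaf_not_psubset:
  assumes "min_leaf_tree F" "stree F'" "leaves V F' \<subseteq> leaves V F - {v}" "v \<in> leaves V F"
  shows False
proof -
  have "card (leaves V F') < card (leaves V F)"
    using assms(3,4) finite_leaves by (intro psubset_card_mono) auto
  then show False using min_leaf_le[OF assms(1,2)] by simp
qed

lemma min_leaf_subset:
  "min_leaf_tree F \<Longrightarrow> stree F' \<Longrightarrow> leaves V F' \<subseteq> leaves V F \<Longrightarrow> min_leaf_tree F'"
  using min_leaf_treeI card_mono finite_leaves by blast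

lemma min_leaf_replace:
  assumes "min_leaf_tree F" "stree F'" "leaves V F' \<subseteq> insert x (leaves V F - {v})" "v \<in> leaves V F"
  shows "min_leaf_tree F'"
proof (rule min_leaf_treeI[OF assms(1,2)])
  have "card (leaves V F') \<le> card (insert x (leaves V F - {v}))"
    using assms finite_leaves by (intro card_mono) auto
  also have "\<dots> \<le> Suc (card (leaves V F - {v}))" by (simp add: card_insert_le_m1 finite_leaves card_insert_if)
  also have "\<dots> = card (leaves V F)" using assms(4) finite_leaves by (intro card_Suc_Diff1)
  finally show "card (leaves V F') \<le> card (leaves V F)" .
qed

text \<open>Supplies an edge on the path between two leaves whose end \<open>y\<close> can lose an
  edge without becoming a leaf.\<close>

lemma branch_between_leaves:
  assumes F: "stree F" and v: "v \<in> leaves V F" and w: "w \<in> leaves V F" "v \<noteq> w"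
    and r: "r \<in> branch_vertices V F"
  shows "\<exists>x y. toward F v y x \<and> toward F w x y \<and> degree F y \<ge> 3"
proof -
  have V: "v \<in> V" "w \<in> V" "r \<in> V" "r \<noteq> v" "r \<noteq> w"
    using v w r by (auto simp: leaves_def branch_vertices_def)
  have dv: "degree F v = 1" "degree F w = 1" "degree F r \<ge> 3"
    using v w r by (auto simp: leaves_def branch_vertices_def)
  \<comment> \<open>The edge \<open>(x, y)\<close> separating \<open>v\<close> from \<open>w\<close> and \<open>r\<close> farthest from \<open>v\<close>: at \<open>y\<close> the paths from \<open>v\<close> to
    \<open>w\<close> and to \<open>r\<close> part.\<close>
  define P where "P = (\<lambda>(x, y). toward F v y x \<and> toward F w x y \<and> toward F r x y)"
  define sz where "sz = (\<lambda>(x, y). card {u. toward F u y x})"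
  have side: "{u. toward F u y x} \<subseteq> V" for x y using toward_in_V[OF F] by blast
  obtain y0 where y0: "toward F w v y0" using toward_exists[OF F V(2,1)] w by auto
  obtain y1 where y1: "toward F r v y1" using toward_exists[OF F V(3,1)] V by auto
  have "y1 = y0" using degree_one_unique dv(1) y0 y1 toward_adj by metis
  moreover have "toward F v y0 v" using toward_adj[OF y0] by (simp add: toward_self adj_commute)
  ultimately have "P (v, y0)" using y0 y1 by (simp add: P_def)
  moreover have "\<forall>z. P z \<longrightarrow> sz z < Suc (card V)"
  proof (intro allI impI)
    fix z assume "P z"
    obtain x y where z: "z = (x, y)" by (cases z)
    show "sz z < Suc (card V)" using card_mono[OF finite_V side] by (simp add: sz_def z less_Suc_eq_le)
  qed
  ultimately obtain z where z: "P z" "\<And>z'. P z' \<Longrightarrow> sz z' \<le> sz z"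
    using ex_has_greatest_nat by metis
  obtain x y where xy: "z = (x, y)" by (cases z)
  have t: "toward F v y x" "toward F w x y" "toward F r x y" using z(1) by (auto simp: P_def xy)
  have "degree F y \<ge> 3"
  proof (cases "y = r")
    case False
    have yV: "y \<in> V" using stree_V[OF F toward_adj[OF t(1)]] by simp
    have "y \<noteq> w" using not_toward_leaf[OF dv(2) V(5)] t(3) by blast
    then obtain a b where ab: "toward F r y a" "toward F w y b"
      using toward_exists[OF F _ yV] V False by metis
    have ne: "a \<noteq> x" "b \<noteq> x" using ab t toward_opposite[OF F] by blast+
    show ?thesis
    \<comment> \<open>If \<open>w\<close> and \<open>r\<close> lie in the same direction from
      \<open>y\<close>, the pair \<open>(y, a)\<close> has a strictly larger side; otherwise
      \<open>x\<close>, \<open>a\<close>, \<open>b\<close> are three neighbours of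
      \<open>y\<close>.\<close>
    proof (cases "a = b")
      case True
      have va: "toward F u a y" if "toward F u y x" for u
        using toward_step[OF F that] ab(1) ne toward_adj by metis
      then have "P (y, a)" using ab True t by (simp add: P_def)
      then have "card {u. toward F u a y} \<le> card {u. toward F u y x}"
        using z(2) by (auto simp: sz_def xy)
      moreover have "toward F y a y" using toward_adj[OF ab(1)] by (simp add: toward_self adj_commute)
      then have "{u. toward F u y x} \<subset> {u. toward F u a y}"
        using va toward_neq[of F y y x] by blast
      ultimately show ?thesis using psubset_card_mono[OF finite_subset[OF side finite_V]] by (metis not_le)
    next
      case False
      then have "card {x, a, b} = 3" using ne by auto
      then show ?thesis using degree_ge_card[OF F, of "{x, a, b}" y] ab t toward_adj by fastforce
    qed
  qed (use dv in simp)
  then show ?thesis using t by blast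
qed

text \<open>Exchanging the edge from \<open>branch_between_leaves\<close> for an edge between
  \<open>v\<close> and \<open>w\<close> removes both from the leaves and leaves at most
  \<open>x\<close> in their place.\<close>

lemma leaves_independent:
  assumes m: "min_leaf_tree F" and r: "r \<in> branch_vertices V F"
    and v: "v \<in> leaves V F" and w: "w \<in> leaves V F"
  shows "\<not> adj Ed v w"
proof
  assume e: "adj Ed v w"
  then have vw: "v \<noteq> w" by auto
  note F = min_leaf_treeD[OF m]
  obtain x y where t: "toward F v y x" "toward F w x y" "degree F y \<ge> 3"
    using branch_between_leaves[OF F v w vw r] by blast
  have d: "degree F v = 1" "degree F w = 1" using v w by (auto simp: leaves_def)
  have yx: "adj F y x" "adj F x y" using toward_adj[OF t(1)] adj_sym by auto
  have ne: "\<not> adj F v w"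
  proof
    assume a: "adj F v w"
    have "w \<noteq> y" using d t by auto
    then have "reach (avoid F y) x w" using t(1) a toward_neq[OF t(1)]
      by (auto simp: toward_def adj_avoid intro: rtranclp.rtrancl_into_rtrancl)
    then show False using t toward_opposite[OF F] by (auto simp: toward_def)
  qed
  let ?F = "swap_edge F x y v w"
  have F': "stree ?F" using stree_exchange[OF F t(1,2) e ne] .
  have dg: "degree ?F u = (degree F u - (if u = x \<or> u = y then 1 else 0)) + (if u = v \<or> u = w then 1 else 0)" for u
    by (rule stree_degree_swap[OF F yx(2) e ne])
  have "x \<noteq> w" using toward_neq[OF t(2)] by simp
  have "leaves V ?F \<subseteq> insert x (leaves V F - {v}) - {w}"
    using dg d t(3) \<open>x \<noteq> w\<close> by (auto simp: leaves_def split: if_splits)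
  moreover have "x = v \<or> x \<notin> leaves V F" using not_toward_leaf[of F x v y] t(1) by (auto simp: leaves_def)
  ultimately have sub: "leaves V ?F \<subseteq> insert x (leaves V F - {v} - {w})" by blast
  have "card (leaves V ?F) \<le> card (insert x (leaves V F - {v} - {w}))"
    using sub finite_leaves by (intro card_mono) auto
  also have "\<dots> \<le> Suc (card (leaves V F - {v} - {w}))" by (simp add: finite_leaves card_insert_if)
  also have "\<dots> = card (leaves V F - {v})" using w vw finite_leaves[of F] by (intro card_Suc_Diff1) auto
  also have "\<dots> < card (leaves V F)" using v finite_leaves by (intro card_Diff1_less)
  finally show False using min_leaf_le[OF m F'] by simp
qed

text \<open>The exchange turns \<open>v\<close> into a vertex of degree two, keeps the degree of
  \<open>y\<close> and lowers that of \<open>x\<close> by one. By minimality \<open>x\<close> must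
  become a leaf.\<close>

lemma toward_leaf_degree:
  assumes m: "min_leaf_tree F" and v: "v \<in> leaves V F" "v \<noteq> x"
    and t: "toward F v y x" and e: "adj Ed v y"
  shows "degree F x = 2" "\<not> adj F v y" "stree (swap_edge F x y v y)"
    "leaves V (swap_edge F x y v y) = insert x (leaves V F - {v})"
proof -
  note F = min_leaf_treeD[OF m]
  have d: "degree F v = 1" using v by (auto simp: leaves_def)
  show ne: "\<not> adj F v y" using toward_unique[OF F t] toward_self[of F y v] v(2) adj_commute by metis
  show F': "stree (swap_edge F x y v y)" by (rule stree_reattach[OF F t e ne])
  have xy: "adj F x y" using toward_adj[OF t] adj_commute by metis
  have dg: "degree (swap_edge F x y v y) u =
     (degree F u - (if u = x \<or> u = y then 1 else 0)) + (if u = v \<or> u = y then 1 else 0)" for u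
    by (rule stree_degree_swap[OF F xy e ne])
  have "degree F x \<noteq> 1" using not_toward_leaf[of F x v y] v t by auto
  then have x2: "degree F x \<ge> 2" using degree_adj[OF F xy] by simp
  have y1: "degree F y \<ge> 1" using degree_adj[OF F toward_adj[OF t]] .
  have vy: "v \<noteq> y" using e by auto
  have xyn: "x \<noteq> y" using xy by auto
  have xV: "x \<in> V" using stree_V[OF F xy] by simp
  show x2': "degree F x = 2"
  proof (rule ccontr)
    assume "degree F x \<noteq> 2"
    then have "leaves V (swap_edge F x y v y) \<subseteq> leaves V F - {v}"
      using dg x2 y1 vy d xyn by (auto simp: leaves_def split: if_splits)
    then show False using min_leaf_not_psubset[OF m F'] v by blast
  qed
  show "leaves V (swap_edge F x y v y) = insert x (leaves V F - {v})"
    using dg x2' y1 vy d xyn xV v by (auto simp: leaves_def split: if_splits)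
qed

text \<open>After the exchange \<open>x\<close> and \<open>w\<close> are both leaves of a tree with
  the fewest leaves, and \<open>r\<close> is still a branch vertex, so
  \<open>leaves_independent\<close> applies.\<close>

lemma toward_leaf_independent:
  assumes m: "min_leaf_tree F" and r: "r \<in> branch_vertices V F" and v: "v \<in> leaves V F" "v \<noteq> x"
    and t: "toward F v y x" and e: "adj Ed v y" and w: "w \<in> leaves V F" "w \<noteq> v"
  shows "\<not> adj Ed x w"
proof -
  note F = min_leaf_treeD[OF m]
  note T = toward_leaf_degree[OF m v t e]
  have "min_leaf_tree (swap_edge F x y v y)"
    by (rule min_leaf_replace[OF m T(3)]) (use T v in auto)
  moreover have "r \<in> branch_vertices V (swap_edge F x y v y)"
    using r T(1) v stree_degree_swap[OF F _ e T(2), of x y r] toward_adj[OF t]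
    by (auto simp: branch_vertices_def adj_commute leaves_def)
  ultimately show ?thesis using leaves_independent T(4) w by blast
qed

text \<open>Exchanging \<open>y y'\<close> for \<open>x y'\<close> creates no leaf because
  \<open>y\<close> keeps degree at least two, but it raises the degree of \<open>x\<close> to three
  while \<open>x\<close> stays the direction of \<open>v\<close>, against
  \<open>toward_leaf_degree\<close>.\<close>

lemma no_chord_at_branch:
  assumes m: "min_leaf_tree F" and v: "v \<in> leaves V F" "v \<noteq> x"
    and t: "toward F v y x" and e: "adj Ed v y"
    and y': "adj F y y'" "y' \<noteq> x" and d3: "degree F y \<ge> 3"
  shows "\<not> adj Ed x y'"
proof
  assume e': "adj Ed x y'"
  note F = min_leaf_treeD[OF m]
  have yx: "adj F y x" using toward_adj[OF t] .
  have ne: "\<not> adj F x y'" using stree_no_triangle[OF F yx y'(1)] y'(2) by blast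
  let ?F = "swap_edge F y y' x y'"
  have "toward F x y' y" by (rule toward_edge) (use y' yx adj_commute in metis)+
  then have F': "stree ?F" by (rule stree_reattach[OF F _ e' ne])
  have dg: "degree ?F u = (degree F u - (if u = y \<or> u = y' then 1 else 0)) + (if u = x \<or> u = y' then 1 else 0)" for u
    by (rule stree_degree_swap[OF F y'(1) e' ne])
  have neq: "x \<noteq> y" "y' \<noteq> y" "v \<noteq> y" using yx y' e by auto
  have pos: "degree F y' \<ge> 1" "degree F x = 2"
    using degree_adj[OF F] y' adj_commute toward_leaf_degree[OF m v t e] by metis+
  have sub: "leaves V ?F \<subseteq> leaves V F" using dg pos d3 neq y' by (auto simp: leaves_def split: if_splits)
  have vL: "v \<in> leaves V ?F" using dg v neq pos y' by (auto simp: leaves_def)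
  have "adj ?F y x" using yx y' e' neq by (subst adj_swap_edge) (auto simp: doubleton_eq_iff)
  moreover have "avoid F y \<subseteq> ?F" by (auto simp: avoid_def swap_edge_def)
  ultimately have "toward ?F v y x" by (rule toward_transfer[OF t])
  then have "degree ?F x = 2" using toward_leaf_degree(1)[OF min_leaf_subset[OF m F' sub] vL] v e by blast
  then show False using dg[of x] pos neq y' by simp
qed

section \<open>Two leaves adjacent to the same vertex\<close>

lemma K14_dest:
  assumes "K14_free V Ed" "adj Ed c a1" "adj Ed c a2" "adj Ed c a3" "adj Ed c a4"
    "a1 \<noteq> a2" "a1 \<noteq> a3" "a1 \<noteq> a4" "a2 \<noteq> a3" "a2 \<noteq> a4" "a3 \<noteq> a4"
  shows "adj Ed a1 a2 \<or> adj Ed a1 a3 \<or> adj Ed a1 a4 \<or> adj Ed a2 a3 \<or> adj Ed a2 a4 \<or> adj Ed a3 a4"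
proof (rule ccontr)
  assume c: "\<not> ?thesis"
  have "card {a1, a2, a3, a4} = 4" using assms by simp
  moreover have "independent_set V Ed {a1, a2, a3, a4}"
    using assms(2-5) edge_in_V[OF subset_refl] c unfolding independent_set_def 
    by (auto simp: adj_commute)
  moreover have "c \<in> V" using edge_in_V[OF subset_refl assms(2)] by simp
  ultimately show False using assms(1-5) unfolding K14_free_def by blast
qed

text \<open>Around \<open>y\<close> the vertices \<open>x\<close>, \<open>y'\<close>,
  \<open>v\<close>, \<open>w\<close> can only have the chord \<open>x y'\<close>. It is excluded by
  \<open>no_chord_at_branch\<close> or, when \<open>y\<close> has degree two, by making
  \<open>y\<close> a leaf adjacent to \<open>w\<close>.\<close>

lemma no_common_direction:
  assumes K: "K14_free V Ed" and m: "min_leaf_tree F" and r: "r \<in> branch_vertices V F"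
    and v: "v \<in> leaves V F" and w: "w \<in> leaves V F" and vw: "v \<noteq> w"
    and e: "adj Ed v y" "adj Ed w y" and t: "toward F v y x" "toward F w y x"
  shows False
proof -
  note F = min_leaf_treeD[OF m]
  have d: "degree F v = 1" "degree F w = 1" using v w by (auto simp: leaves_def)
  have ne: "v \<noteq> x" "w \<noteq> x" using not_toward_leaf d t vw by metis+
  have x2: "degree F x = 2" and nv: "\<not> adj F v y" using toward_leaf_degree[OF m v ne(1) t(1) e(1)] by auto
  have nw: "\<not> adj F w y" using toward_leaf_degree[OF m w ne(2) t(2) e(2)] by auto
  have xv: "\<not> adj Ed x v" "\<not> adj Ed x w"
    using toward_leaf_independent[OF m r w ne(2) t(2) e(2) v vw]
      toward_leaf_independent[OF m r v ne(1) t(1) e(1) w vw[symmetric]] by auto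
  have vw': "\<not> adj Ed v w" using leaves_independent[OF m r v w] .
  have yx: "adj F y x" using toward_adj[OF t(1)] .
  then have yV: "y \<in> V" using stree_V[OF F] by blast
  have "y \<notin> leaves V F" using leaves_independent[OF m r v] e by blast
  then have y2: "degree F y \<ge> 2" using degree_adj[OF F yx] yV by (auto simp: leaves_def)
  then obtain y' where y': "adj F y y'" "y' \<noteq> x"
  proof -
    have "card {u. adj F y u} \<noteq> card {x}" using y2 by (simp add: degree_def)
    then have "{u. adj F y u} \<noteq> {x}" by metis
    then show ?thesis using yx that by auto
  qed
  have y'vw: "y' \<noteq> v" "y' \<noteq> w" using y' nv nw adj_commute by metis+
  have Ed: "adj Ed y x" "adj Ed y y'" "adj Ed y v" "adj Ed y w"
    using yx y' e adj_mono[OF stree_subset[OF F]] adj_commute by metis+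
  \<comment> \<open>From \<open>y'\<close> the direction of \<open>u\<close> is \<open>y\<close>, so
    an edge \<open>y' u\<close> would forbid \<open>y\<close> to be adjacent to the other of the two
    leaves.\<close>
  have no: "\<not> adj Ed y' u" if u: "u \<in> leaves V F" "u = v \<or> u = w" for u
  proof
    assume a: "adj Ed y' u"
    have "toward F u y' y" using toward_step[OF F _ y'] t u by blast
    moreover have "u \<noteq> y" using e u by auto
    ultimately have "\<not> adj Ed y u'" if "u' \<noteq> u" "u' \<in> leaves V F" for u'
      using toward_leaf_independent[OF m r u(1)] adj_sym[OF a] that by metis
    then show False using Ed v w vw u(2) by (cases "u = v") auto
  qed
  have e': "adj Ed x y'"
    using K14_dest[OF K Ed y'(2)[symmetric] ne[symmetric] y'vw vw] vw' xv no v w by blast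
  show False
  proof (cases "degree F y \<ge> 3")
    case True
    then show False using no_chord_at_branch[OF m v ne(1) t(1) e(1) y'] e' by blast
  next
    case False
    then have y2': "degree F y = 2" using y2 by simp
    have nxy: "\<not> adj F x y'" using stree_no_triangle[OF F yx y'(1)] y'(2) by blast
    let ?F1 = "swap_edge F y y' x y'"
    have "toward F x y' y" by (rule toward_edge) (use y' yx adj_commute in metis)+
    then have F1: "stree ?F1" by (rule stree_reattach[OF F _ e' nxy])
    have dg1: "degree ?F1 u = (degree F u - (if u = y \<or> u = y' then 1 else 0)) + (if u = x \<or> u = y' then 1 else 0)" for u
      by (rule stree_degree_swap[OF F y'(1) e' nxy])
    have neq: "x \<noteq> y" "y' \<noteq> y" "v \<noteq> y" "w \<noteq> y" using yx y' e by auto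
    have yx1: "adj ?F1 y x" using yx y' e' neq by (subst adj_swap_edge) (auto simp: doubleton_eq_iff)
    moreover have "avoid F y \<subseteq> ?F1" by (auto simp: avoid_def swap_edge_def)
    ultimately have t1: "toward ?F1 v y x" by (rule toward_transfer[OF t(1)])
    have nv1: "\<not> adj ?F1 v y" using nv neq e' y'vw ne by (subst adj_swap_edge) (auto simp: doubleton_eq_iff)
    \<comment> \<open>The two exchanges together bypass \<open>y\<close> by the edge
      \<open>x y'\<close> and hang it on \<open>v\<close> as a leaf; all degrees except those of
      \<open>v\<close> and \<open>y\<close> are restored.\<close>
    let ?F2 = "swap_edge ?F1 x y v y"
    have F2: "stree ?F2" using stree_reattach[OF F1 t1 e(1) nv1] .
    have dg2: "degree ?F2 u = (degree ?F1 u - (if u = x \<or> u = y then 1 else 0)) + (if u = v \<or> u = y then 1 else 0)" for u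
      using stree_degree_swap[OF F1 _ e(1) nv1] yx1 adj_commute by metis
    have y1: "degree F y' \<ge> 1" using degree_adj[OF F] y' adj_commute by metis
    have D: "degree ?F2 u = (if u = v then 2 else if u = y then 1 else degree F u)" for u
      using dg1 dg2 y1 y2' x2 d neq ne y'vw y'(2) by auto
    have L2: "leaves V ?F2 = insert y (leaves V F - {v})"
      using D yV neq by (auto simp: leaves_def split: if_splits)
    have "min_leaf_tree ?F2" by (rule min_leaf_replace[OF m F2 _ v, of y]) (simp add: L2)
    moreover have "r \<in> branch_vertices V ?F2" using r D d y2' by (auto simp: branch_vertices_def)
    ultimately show False using leaves_independent[of ?F2 r y w] L2 w vw Ed by blast
  qed
qed

section \<open>Pushing branch vertices away from the root\<close>

definition potential :: "'a set set \<Rightarrow> 'a \<Rightarrow> nat" where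
  "potential F r = (\<Sum>u\<in>V. (degree F u - 2) * dist_in F r u)"

definition optimal :: "'a set set \<Rightarrow> 'a \<Rightarrow> bool" where
  "optimal F r \<longleftrightarrow> min_leaf_tree F \<and> r \<in> branch_vertices V F \<and>
     (\<forall>F'. min_leaf_tree F' \<and> r \<in> branch_vertices V F' \<longrightarrow> potential F' r \<le> potential F r)"

lemma optimalD:
  assumes "optimal F r"
  shows "min_leaf_tree F" "r \<in> branch_vertices V F" "stree F" "r \<in> V"
  using assms min_leaf_treeD by (auto simp: optimal_def branch_vertices_def)

text \<open>Potentials are compared term by term. Distances matter at branch vertices only, since
  truncated subtraction gives all other vertices weight zero.\<close>

lemma optimal_no_increase:
  assumes o: "optimal F r" and m: "min_leaf_tree F'" and r: "r \<in> branch_vertices V F'"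
    and le: "\<And>u. u \<in> V \<Longrightarrow> degree F u \<ge> 3 \<Longrightarrow> dist_in F r u \<le> dist_in F' r u"
    and deg: "\<And>u. u \<in> V \<Longrightarrow> degree F u - 2 \<le> degree F' u - 2"
    and b: "b \<in> V" "degree F b \<ge> 3" "dist_in F r b < dist_in F' r b"
  shows False
proof -
  have "potential F r < potential F' r"
    unfolding potential_def
  proof (rule sum_strict_mono_ex1[OF finite_V])
    show "\<forall>u\<in>V. (degree F u - 2) * dist_in F r u \<le> (degree F' u - 2) * dist_in F' r u"
    proof
      fix u assume u: "u \<in> V"
      show "(degree F u - 2) * dist_in F r u \<le> (degree F' u - 2) * dist_in F' r u"
        using le[OF u] deg[OF u] by (cases "degree F u \<ge> 3") (auto intro: mult_le_mono)
    qed
    have "0 < degree F b - 2" using b(2) by simp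
    then have "(degree F b - 2) * dist_in F r b < (degree F b - 2) * dist_in F' r b" using b(3) by simp
    also have "\<dots> \<le> (degree F' b - 2) * dist_in F' r b" using deg[OF b(1)] by simp
    finally show "\<exists>u\<in>V. (degree F u - 2) * dist_in F r u < (degree F' u - 2) * dist_in F' r u"
      using b(1) by blast
  qed
  then show False using o m r unfolding optimal_def by (meson not_le)
qed

text \<open>A chord between two children \<open>c1\<close>, \<open>c2\<close> of \<open>b\<close> would allow pushing the branching
  at \<open>b\<close> one step down to \<open>c2\<close>, away from the root.\<close>

lemma optimal_children_nonadjacent:
  assumes o: "optimal F r" and b: "degree F b \<ge> 3" "b \<noteq> r"
    and c: "toward F r c1 b" "toward F r c2 b" "c1 \<noteq> c2"
  shows "\<not> adj Ed c2 c1"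
proof
  assume e: "adj Ed c2 c1"
  note m = optimalD(1)[OF o] and r = optimalD(2)[OF o] and F = optimalD(3)[OF o]
  have a: "adj F b c1" "adj F b c2" using toward_adj c adj_sym by metis+
  have V: "b \<in> V" "c1 \<in> V" "c2 \<in> V" using stree_V[OF F] a by auto
  have ne: "\<not> adj F c2 c1" using stree_no_triangle[OF F a(2,1)] c(3) by blast
  have neq: "c1 \<noteq> b" "c2 \<noteq> b" using a by auto
  have "toward F c2 c1 b" by (rule toward_edge[OF adj_sym[OF a(1)] a(2)]) (use c in auto)
  let ?F = "swap_edge F b c1 c2 c1"
  have F': "stree ?F" by (rule stree_reattach[OF F \<open>toward F c2 c1 b\<close> e ne])
  have dg: "degree ?F u = (degree F u - (if u = b \<or> u = c1 then 1 else 0)) + (if u = c2 \<or> u = c1 then 1 else 0)" for u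
    by (rule stree_degree_swap[OF F a(1) e ne])
  have pos: "degree F c1 \<ge> 1" "degree F c2 \<ge> 1" using degree_adj[OF F] a adj_sym by metis+
  have sub: "leaves V ?F \<subseteq> leaves V F - {c2}"
    using dg b pos neq c(3) by (auto simp: leaves_def split: if_splits)
  \<comment> \<open>Needed so that the truncated weight of \<open>c2\<close> really grows by one
    when it gains an edge.\<close>
  have c2: "degree F c2 \<ge> 2"
  proof (rule ccontr)
    assume "\<not> degree F c2 \<ge> 2"
    then have "c2 \<in> leaves V F" using pos V by (auto simp: leaves_def)
    then show False using min_leaf_not_psubset[OF m F' sub] by blast
  qed
  have m': "min_leaf_tree ?F" using min_leaf_subset[OF m F'] sub by blast
  have r': "r \<in> branch_vertices V ?F" using r dg[of r] b pos by (auto simp: branch_vertices_def)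
  let ?h = "dist_in F r"
  have rch: "reach F r x" if "x \<in> V" for x
    using connectedD[OF stree_connected[OF F]] optimalD(4)[OF o] that by blast
  have h: "?h c1 = Suc (?h b)" "?h c2 = Suc (?h b)" using dist_in_toward[OF F optimalD(4)[OF o]] c by auto
  \<comment> \<open>The new edge joins two vertices of equal depth, so the old distance still grows
    by at most one along every edge of the new tree.\<close>
  have le: "?h u \<le> dist_in ?F r u" if "u \<in> V" for u
  proof (rule dist_in_greatest)
    show "reach ?F r u" using connectedD[OF stree_connected[OF F']] optimalD(4)[OF o] that by blast
    fix x y assume "adj ?F x y"
    then have "{x, y} = {c2, c1} \<or> adj F x y" using c(3) by (subst (asm) adj_swap_edge) auto
    then show "?h y \<le> Suc (?h x)"
    proof
      assume a: "adj F x y"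
      then show ?thesis using dist_in_adj[OF rch a] stree_V[OF F a] by blast
    qed (use h in \<open>auto simp: doubleton_eq_iff\<close>)
  qed simp
  define w where "w = (\<lambda>(F :: 'a set set) u. degree F u - 2)"
  have wc: "w ?F c2 = Suc (w F c2)" "Suc (w ?F b) = w F b"
    using dg[of c2] dg[of b] c2 b(1) neq c(3) pos by (auto simp: w_def)
  have wu: "w ?F u = w F u" if "u \<noteq> b" "u \<noteq> c2" for u
    using dg[of u] that pos by (auto simp: w_def)
  \<comment> \<open>Only \<open>b\<close> and \<open>c2\<close> change weight: one unit moves from
    \<open>b\<close> to \<open>c2\<close>, which is one step deeper.\<close>
  have split: "potential F' r = w F' b * dist_in F' r b + (w F' c2 * dist_in F' r c2 +
      (\<Sum>u\<in>V - {b} - {c2}. w F' u * dist_in F' r u))" for F'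
    unfolding potential_def w_def using V neq finite_V
    by (subst sum.remove[of _ b], simp, simp, subst sum.remove[of _ c2]) auto
  have "(\<Sum>u\<in>V - {b} - {c2}. w F u * ?h u) \<le> (\<Sum>u\<in>V - {b} - {c2}. w ?F u * dist_in ?F r u)"
    by (rule sum_mono) (use wu le in \<open>auto intro!: mult_le_mono\<close>)
  moreover have "w F b * ?h b + w F c2 * ?h c2 < w ?F b * ?h b + w ?F c2 * ?h c2"
    using h wc(1) by (simp flip: wc(2))
  moreover have "w ?F b * ?h b \<le> w ?F b * dist_in ?F r b" "w ?F c2 * ?h c2 \<le> w ?F c2 * dist_in ?F r c2"
    using le V by (auto intro: mult_le_mono)
  ultimately have "potential F r < potential ?F r" unfolding split by linarith
  then show False using o m' r' unfolding optimal_def by (meson not_le)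
qed

text \<open>If \<open>v\<close> is adjacent to \<open>b\<close> and to its parent \<open>q\<close>, then inserting \<open>v\<close> into the edge between
  them pushes \<open>b\<close> away from the root.\<close>

lemma optimal_no_insertion:
  assumes o: "optimal F r" and b: "degree F b \<ge> 3" and v: "v \<in> leaves V F"
    and t: "toward F r b q" "toward F v b q" and e: "adj Ed v b" "adj Ed q v"
  shows False
proof -
  note m = optimalD(1)[OF o] and r = optimalD(2)[OF o] and F = optimalD(3)[OF o]
  have dv: "degree F v = 1" "v \<in> V" using v by (auto simp: leaves_def)
  have dr: "degree F r \<ge> 3" using r by (simp add: branch_vertices_def)
  have vr: "v \<noteq> r" using dv dr by auto
  have vq: "v \<noteq> q" using e by auto
  have bq: "adj F b q" using toward_adj[OF t(1)] .
  have q2: "degree F q = 2" and nvb: "\<not> adj F v b"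
    using toward_leaf_degree[OF m v vq t(2) e(1)] by auto
  have V: "b \<in> V" "q \<in> V" using stree_V[OF F bq] by auto
  have qr: "q \<noteq> r" using q2 dr by auto
  have neq: "b \<noteq> q" "v \<noteq> b" using bq e by auto
  obtain p where p: "toward F q v p" using toward_exists[OF F V(2) dv(2)] vq by auto
  have vp: "adj F v p" using toward_adj[OF p] .
  \<comment> \<open>The two tree edges at \<open>q\<close> lead to \<open>b\<close> and towards the
    root, leaving none for \<open>v\<close>.\<close>
  have nqv: "\<not> adj F q v"
  proof
    assume a: "adj F q v"
    obtain z where z: "toward F r q z" using toward_exists[OF F optimalD(4)[OF o] V(2)] qr by auto
    have "z \<noteq> v" using not_toward_leaf[OF dv(1)] vr z by metis
    moreover have "z \<noteq> b" using toward_opposite[OF F t(1)] z by blast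
    ultimately have "card {b, v, z} = 3" using neq by auto
    then show False using degree_ge_card[OF F, of "{b, v, z}" q] a adj_sym[OF bq] toward_adj[OF z] q2 by auto
  qed
  have pq: "p \<noteq> q" "p \<noteq> b" "p \<noteq> v" using vp nqv nvb adj_sym[OF vp] by auto
  \<comment> \<open>The insertion takes two exchanges: \<open>v\<close> is moved from
    \<open>p\<close> to \<open>q\<close>, then \<open>b\<close> is moved from \<open>q\<close> to
    \<open>v\<close>.\<close>
  let ?F1 = "swap_edge F p v q v"
  have F1: "stree ?F1" by (rule stree_reattach[OF F p e(2) nqv])
  have adj1: "adj ?F1 x y \<longleftrightarrow> {x, y} = {q, v} \<or> adj F x y \<and> {x, y} \<noteq> {p, v}" for x y
    using vq by (subst adj_swap_edge) auto
  have nvb1: "\<not> adj ?F1 v b" using nvb neq by (subst adj1) (auto simp: doubleton_eq_iff)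
  have qb1: "adj ?F1 q b" using adj_sym[OF bq] pq neq vq by (subst adj1) (auto simp: doubleton_eq_iff)
  have t1: "toward ?F1 v b q"
    by (rule toward_edge[OF adj_sym[OF qb1]]) (use adj1 neq in auto)
  let ?F = "swap_edge ?F1 q b v b"
  have F': "stree ?F" by (rule stree_reattach[OF F1 t1 e(1) nvb1])
  have adj2: "adj ?F x y \<longleftrightarrow> {x, y} = {v, b} \<or> {x, y} = {q, v} \<or>
      adj F x y \<and> {x, y} \<noteq> {p, v} \<and> {x, y} \<noteq> {q, b}" for x y
  proof -
    have "{q, v} \<noteq> {q, b}" using neq by (auto simp: doubleton_eq_iff)
    then show ?thesis unfolding adj_swap_edge[OF neq(2)] adj1 by metis
  qed
  have dg1: "degree ?F1 u = (degree F u - (if u = p \<or> u = v then 1 else 0)) + (if u = q \<or> u = v then 1 else 0)" for u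
    by (rule stree_degree_swap[OF F adj_sym[OF vp] e(2) nqv])
  have dg2: "degree ?F u = (degree ?F1 u - (if u = q \<or> u = b then 1 else 0)) + (if u = v \<or> u = b then 1 else 0)" for u
    by (rule stree_degree_swap[OF F1 qb1 e(1) nvb1])
  have dg: "degree ?F u = (if u = p then degree F p - 1 else if u = v then 2 else degree F u)" for u
    unfolding dg2 dg1 using pq neq vq dv(1) b
    by (cases "u = p"; cases "u = v"; cases "u = q"; cases "u = b") simp_all
  have "degree F p \<noteq> 1"
    using not_toward_leaf[of F p q v] p pq by auto
  then have p2: "degree F p \<ge> 2" using degree_adj[OF F adj_sym[OF vp]] by simp
  \<comment> \<open>Thus \<open>p\<close> replaces \<open>v\<close> as a leaf and was no branch
    vertex, so its lost edge costs no weight.\<close>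
  have p2': "degree F p = 2"
  proof (rule ccontr)
    assume "degree F p \<noteq> 2"
    then have "leaves V ?F \<subseteq> leaves V F - {v}" using dg p2 by (auto simp: leaves_def split: if_splits)
    then show False using min_leaf_not_psubset[OF m F'] v by blast
  qed
  have m': "min_leaf_tree ?F"
    by (rule min_leaf_replace[OF m F' _ v, of p]) (use dg in \<open>auto simp: leaves_def split: if_splits\<close>)
  have r': "r \<in> branch_vertices V ?F" using r dg[of r] p2' vr dr by (auto simp: branch_vertices_def)
  let ?h = "dist_in F r"
  have rch: "reach F r x" if "x \<in> V" for x
    using connectedD[OF stree_connected[OF F]] optimalD(4)[OF o] that by blast
  have lip: "?h y \<le> Suc (?h x)" if "adj F x y" for x y
    using dist_in_adj[OF rch that] stree_V[OF F that] by blast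
  \<comment> \<open>Lower bound for the new distances: \<open>v\<close> takes the old depth of
    \<open>b\<close>, and everything on the side of \<open>b\<close> moves one step deeper.\<close>
  define g where "g u = (if u = v then ?h b else if toward F u q b then Suc (?h u) else ?h u)" for u
  have nr: "\<not> toward F r q b" using toward_opposite[OF F t(1)] .
  have gq: "g q = ?h q" using vq toward_neq[of F q q b] by (auto simp: g_def)
  have gb: "g b = Suc (?h b)" using neq toward_self[OF adj_sym[OF bq]] by (auto simp: g_def)
  have gv: "g v = ?h b" by (simp add: g_def)
  have le: "g u \<le> dist_in ?F r u" if "u \<in> V" for u
  proof (rule dist_in_greatest)
    show "reach ?F r u" using connectedD[OF stree_connected[OF F']] optimalD(4)[OF o] that by blast
    show "g r = 0" using nr vr by (simp add: g_def)
    fix x y assume "adj ?F x y"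
    then consider "{x, y} = {v, b}" | "{x, y} = {q, v}" | "adj F x y" "{x, y} \<noteq> {p, v}" "{x, y} \<noteq> {q, b}"
      unfolding adj2 by metis
    then show "g y \<le> Suc (g x)"
    proof cases
      case 3
      have "x \<noteq> v" using 3(1,2) degree_one_unique[OF dv(1) vp, of y] by auto
      moreover have "y \<noteq> v" using adj_sym[OF 3(1)] 3(2) degree_one_unique[OF dv(1) vp, of x] by auto
      moreover have nxy: "{x, y} \<noteq> {b, q}" "{y, x} \<noteq> {b, q}" using 3(3) by (simp_all add: insert_commute)
      have "toward F x q b \<longleftrightarrow> toward F y q b"
        using side_closed[OF F _ 3(1), of q b] side_closed[OF F _ adj_sym[OF 3(1)], of q b] nxy by blast
      ultimately show ?thesis using lip[OF 3(1)] by (auto simp: g_def)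
    qed (use gq gb gv lip[OF bq] lip[OF adj_sym[OF bq]] in \<open>auto simp: doubleton_eq_iff\<close>)
  qed
  show False
  proof (rule optimal_no_increase[OF o m' r'])
    show "?h u \<le> dist_in ?F r u" if "u \<in> V" "degree F u \<ge> 3" for u
      using le[OF that(1)] that(2) dv by (auto simp: g_def split: if_splits)
    show "degree F u - 2 \<le> degree ?F u - 2" for u using dg[of u] p2' dv by auto
    show "?h b < dist_in ?F r b" using le[OF V(1)] gb by simp
  qed (use V b in auto)
qed

text \<open>Otherwise \<open>v\<close>, the parent \<open>q\<close> and two children
  \<open>c1\<close>, \<open>c2\<close> of \<open>b\<close> would form an induced \<open>K14\<close>
  centred at \<open>b\<close>; each possible chord is excluded by an earlier exchange
  argument.\<close>

lemma optimal_branch_nonadjacent: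
  assumes K: "K14_free V Ed" and o: "optimal F r" and b: "b \<in> branch_vertices V F" 
    and v: "v \<in> leaves V F" and t: "toward F r b q" "toward F v b q" and e: "adj Ed v b"
  shows False
proof -
  note m = optimalD(1)[OF o] and r = optimalD(2)[OF o] and F = optimalD(3)[OF o]
  have d: "degree F v = 1" "degree F b \<ge> 3" "degree F r \<ge> 3" 
    using v b r by (auto simp: leaves_def branch_vertices_def)
  have "r \<noteq> v" using d by auto
  then have vq: "v \<noteq> q" using not_toward_leaf[OF d(1), of r b] t(1) by auto
  have br: "b \<noteq> r" using toward_neq[OF t(1)] by simp
  have bq: "adj F b q" using toward_adj[OF t(1)] .
  have nvb: "\<not> adj F v b" using toward_leaf_degree[OF m v vq t(2) e] by auto
  have nvq: "\<not> adj Ed v q" using optimal_no_insertion[OF o d(2) v t e] adj_sym[of Ed v q] by blast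
  have "\<not> {u. adj F b u} - {q} \<subseteq> {c}" for c
  proof
    assume "{u. adj F b u} - {q} \<subseteq> {c}"
    then have "{u. adj F b u} \<subseteq> {q, c}" by blast
    then have "degree F b \<le> card {q, c}" unfolding degree_def by (rule card_mono[rotated]) simp
    also have "\<dots> \<le> 2" by (simp add: card_insert_if)
    finally show False using d(2) by simp
  qed
  then obtain c1 c2 where c: "adj F b c1" "c1 \<noteq> q" "adj F b c2" "c2 \<noteq> q" "c1 \<noteq> c2" by blast
  have tc: "toward F r c1 b" "toward F r c2 b" using toward_step[OF F t(1)] c by auto
  have c12: "\<not> adj Ed c2 c1" by (rule optimal_children_nonadjacent[OF o d(2) br tc c(5)])
  have qc: "\<not> adj Ed q c1" "\<not> adj Ed q c2" using no_chord_at_branch[OF m v vq t(2) e _ _ d(2)] c by auto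
  have vb: "v \<noteq> b" using e by auto
  \<comment> \<open>From the child \<open>c\<close> the direction of \<open>v\<close> is
    \<open>b\<close>, whose degree exceeds two.\<close>
  have vc: "\<not> adj Ed v c" if "adj F b c" "c \<noteq> q" for c
    using toward_leaf_degree(1)[OF m v vb toward_step[OF F t(2) that]] d(2) by auto
  have vneq: "v \<noteq> c1" "v \<noteq> c2" using nvb adj_sym[OF c(1)] adj_sym[OF c(3)] by auto
  have "F \<subseteq> Ed" using stree_subset[OF F] .
  then have Ed: "adj Ed b v" "adj Ed b q" "adj Ed b c2" "adj Ed b c1"
    using adj_sym[OF e] bq c adj_mono by metis+
  show False
    using K14_dest[OF K Ed vq vneq(2,1) c(4,2)[symmetric] c(5)[symmetric]] nvq vc[OF c(1,2)] vc[OF c(3,4)] c12 qc by blast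
qed

section \<open>Bounding the degree sum of the leaves by an injection\<close>

lemma degree_sum_leaves:
  assumes K: "K14_free V Ed" and o: "optimal F r"
  shows "(\<Sum>v\<in>leaves V F. degree Ed v) + card (branch_vertices V F) \<le> card V"
proof -
  note m = optimalD(1)[OF o] and r = optimalD(2)[OF o] and F = optimalD(3)[OF o]
  let ?L = "leaves V F" and ?B = "branch_vertices V F"
  \<comment> \<open>Meaningful for distinct vertices only; \<open>p r r\<close> is unspecified, so
    \<open>up\<close> treats \<open>y = r\<close> separately.\<close>
  define p where "p u y = (THE x. toward F u y x)" for u y
  have p: "toward F u y (p u y)" if "u \<in> V" "y \<in> V" "u \<noteq> y" for u y
    unfolding p_def using toward_exists[OF F that] toward_unique[OF F] by (metis theI)
  have pI: "p u y = x" if "toward F u y x" for u y x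
    unfolding p_def using that toward_unique[OF F] by blast
  \<comment> \<open>\<open>up v y\<close>: the vertex \<open>y\<close> is an ancestor of \<open>v\<close> in the tree rooted at \<open>r\<close>.\<close>
  define up where "up v y \<longleftrightarrow> y = r \<or> p v y \<noteq> p r y" for v y
  define g where "g = (\<lambda>(v, y). if up v y then p v y else y)"
  define P where "P = Sigma ?L (\<lambda>v. {y. adj Ed v y})"
  have LV: "v \<in> V" if "v \<in> ?L" for v using that by (simp add: leaves_def)
  have nbr: "y \<in> V" "v \<noteq> y" if "adj Ed v y" for v y using that edge_in_V[OF subset_refl] by auto
  have P: "v \<in> ?L" "v \<in> V" "y \<in> V" "v \<noteq> y" "adj Ed v y" "toward F v y (p v y)" if "(v, y) \<in> P" for v y
    using that LV nbr p by (auto simp: P_def)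
  have rB: "degree F r \<ge> 3" using r by (simp add: branch_vertices_def)
  \<comment> \<open>If \<open>v\<close> does not lie below \<open>y\<close>, then
    \<open>p v y\<close> is the parent of \<open>y\<close>; in the other case, treated next, it is a
    child of \<open>y\<close>.\<close>
  have down: "toward F r y (p v y)" "y \<noteq> r" if "(v, y) \<in> P" "\<not> up v y" for v y
    using that p[of r y] P[OF that(1)] optimalD(4)[OF o] by (auto simp: up_def)
  have upw: "toward F r (p v y) y" if "(v, y) \<in> P" "up v y" for v y
  proof -
    have a: "adj F y (p v y)" using toward_adj[OF P(6)[OF that(1)]] .
    show ?thesis
    proof (cases "y = r")
      case True
      then show ?thesis using a by (simp add: toward_self adj_sym)
    next
      case False
      then show ?thesis
        using toward_step[OF F p[OF optimalD(4)[OF o] P(3)[OF that(1)]] a] that(2) by (auto simp: up_def)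
    qed
  qed
  have img: "g ` P \<subseteq> V - ?B"
  proof (clarify)
    fix v y assume vy: "(v, y) \<in> P"
    note Pv = P[OF vy]
    show "g (v, y) \<in> V - ?B"
    proof (cases "up v y")
      case True
      have "p v y \<in> V" using stree_V[OF F toward_adj[OF Pv(6)]] by simp
      moreover have "degree F (p v y) < 3"
      proof (cases "p v y = v")
        case False
        then show ?thesis using toward_leaf_degree(1)[OF m Pv(1) _ Pv(6) Pv(5)] by force
      qed (use Pv(1) in \<open>simp add: leaves_def\<close>)
      ultimately show ?thesis using True by (simp add: g_def branch_vertices_def)
    next
      case False
      then have "y \<notin> ?B" using optimal_branch_nonadjacent[OF K o _ Pv(1) down(1)[OF vy] Pv(6,5)] by blast
      then show ?thesis using False Pv(3) by (simp add: g_def)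
    qed
  qed
  \<comment> \<open>Here \<open>z\<close> is a child of \<open>y\<close> on the way to
    \<open>v\<close>, while \<open>w\<close> is adjacent to \<open>z\<close> and lies beyond its
    parent \<open>y\<close>. So \<open>z\<close> is either the leaf \<open>v\<close> or a vertex
    that \<open>toward_leaf_independent\<close> keeps nonadjacent to \<open>w\<close>.\<close>
  have mixed: False if "(v, y) \<in> P" "up v y" "(w, z) \<in> P" "\<not> up w z" "p v y = z" for v y w z
  proof -
    note Pv = P[OF that(1)] and Pw = P[OF that(3)]
    have zy: "p w z = y" using toward_unique[OF F upw[OF that(1,2)]] down[OF that(3,4)] that(5) by simp
    then have vw: "w \<noteq> v" using toward_opposite[OF F Pv(6)] Pw(6) that(5) by auto
    show False
    proof (cases "z = v")
      case True
      then show False using leaves_independent[OF m r Pw(1) Pv(1)] Pw(5) by simp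
    next
      case False
      then show False
        using toward_leaf_independent[OF m r Pv(1) _ Pv(6) Pv(5) Pw(1) vw] that(5) adj_sym[OF Pw(5)] by auto
    qed
  qed
  have same: "v = w" if "(v, y) \<in> P" "(w, y) \<in> P" "p v y = p w y" for v w y
    using no_common_direction[OF K m r, of v w y] P[OF that(1)] P[OF that(2)] that(3) by metis
  have inj: "inj_on g P"
  proof (rule inj_onI, clarify)
    fix v y w z assume vy: "(v, y) \<in> P" and wz: "(w, z) \<in> P" and eq: "g (v, y) = g (w, z)"
    show "v = w \<and> y = z"
    \<comment> \<open>In the two pure cases the common value determines \<open>y\<close>, as its
      parent or as itself, and then \<open>same\<close> gives \<open>v = w\<close>.\<close>
    proof (cases "up v y"; cases "up w z")
      assume u: "up v y" "up w z"
      then have "p v y = p w z" using eq by (simp add: g_def)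
      moreover from this have "y = z" using toward_unique[OF F upw[OF vy u(1)]] upw[OF wz u(2)] by simp
      ultimately show ?thesis using same vy wz by auto
    next
      assume u: "\<not> up v y" "\<not> up w z"
      then have "y = z" using eq by (simp add: g_def)
      moreover from this have "p v y = p w z" using u by (simp add: up_def)
      ultimately show ?thesis using same vy wz by auto
    qed (use mixed vy wz eq in \<open>auto simp: g_def\<close>)
  qed
  have "(\<Sum>v\<in>?L. degree Ed v) = card P"
    unfolding P_def degree_def using finite_leaves finite_nbrs[OF subset_refl] by simp
  also have "\<dots> \<le> card (V - ?B)" using card_inj_on_le[OF inj img] finite_V by simp
  also have "\<dots> = card V - card ?B" using finite_V by (intro card_Diff_subset) (auto simp: branch_vertices_def)
  finally show ?thesis using card_mono[OF finite_V, of ?B] by (auto simp: branch_vertices_def)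
qed

section \<open>Counting leaves and branch vertices, and the conclusion\<close>

lemma degree_sum_edges:
  assumes "F \<subseteq> Ed"
  shows "(\<Sum>v\<in>V. degree F v) = 2 * card F"
  using finite_subset[OF assms finite_Ed] assms
proof (induction F rule: finite_induct)
  case empty
  then show ?case by (simp add: degree_def adj_def)
next
  case (insert e F)
  then obtain a b where ab: "a \<noteq> b" "a \<in> V" "b \<in> V" "e = {a, b}"
    using simple unfolding simple_graph_def by blast
  have F: "F \<subseteq> Ed" "\<not> adj F a b" using insert ab by (auto simp: adj_def)
  have "(\<Sum>v\<in>V. degree (insert e F) v) = (\<Sum>v\<in>V. degree F v + ((if v = a then 1 else 0) + (if v = b then 1 else 0)))"
    using degree_insert[OF finite_nbrs[OF F(1)] ab(1) F(2)] ab by (intro sum.cong) auto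
  also have "\<dots> = 2 * card F + 2" using insert.IH F ab finite_V by (simp add: sum.distrib)
  finally show ?case using insert by simp
qed

text \<open>Sums the local inequality \<open>2 + [branch] \<le> degree + [leaf]\<close> over all
  vertices; the degrees of a tree add up to \<open>2 * card V - 2\<close>.\<close>

lemma branch_leaf_count:
  assumes F: "stree F" and V: "card V \<ge> 2"
  shows "card (branch_vertices V F) + 2 \<le> card (leaves V F)"
proof -
  let ?L = "leaves V F" and ?B = "branch_vertices V F"
  have "degree F v \<ge> 1" if v: "v \<in> V" for v
  proof -
    have "V \<noteq> {v}" using V by auto
    then obtain u where "u \<in> V" "u \<noteq> v" using v by blast
    then show ?thesis using toward_exists[OF F _ v] toward_adj degree_adj[OF F] by metis
  qed
  then have "2 + (if v \<in> ?B then 1 else 0) \<le> degree F v + (if v \<in> ?L then 1 else 0)" if "v \<in> V" for v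
    using that by (force simp: leaves_def branch_vertices_def)
  then have "(\<Sum>v\<in>V. 2 + (if v \<in> ?B then 1 else 0)) \<le> (\<Sum>v\<in>V. degree F v + (if v \<in> ?L then 1 else 0))"
    by (rule sum_mono)
  moreover have "V \<inter> ?L = ?L" "V \<inter> ?B = ?B" by (auto simp: leaves_def branch_vertices_def)
  ultimately have "2 * card V + card ?B \<le> 2 * card F + card ?L"
    using degree_sum_edges[OF stree_subset[OF F]] finite_V
    unfolding sum.distrib by (simp flip: sum.inter_restrict)
  then show ?thesis using stree_card[OF F] by simp
qed

lemma optimal_exists:
  assumes "connected_graph V Ed" "\<And>F. stree F \<Longrightarrow> branch_vertices V F \<noteq> {}"
  shows "\<exists>F r. optimal F r"
proof -
  obtain F0 where "stree F0" using stree_exists[OF assms(1)] by blast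
  then obtain F where F: "stree F" "\<And>F'. stree F' \<Longrightarrow> card (leaves V F) \<le> card (leaves V F')"
    using ex_has_least_nat[of stree F0 "\<lambda>F. card (leaves V F)"] by blast
  then have "min_leaf_tree F" by (simp add: min_leaf_tree_def)
  moreover obtain r where "r \<in> branch_vertices V F" using assms(2)[OF F(1)] by blast
  ultimately have ne: "F \<in> {F. min_leaf_tree F \<and> r \<in> branch_vertices V F}" by simp
  have fin: "finite {F. min_leaf_tree F \<and> r \<in> branch_vertices V F}"
    by (rule finite_subset[of _ "Pow Ed"]) (use finite_Ed stree_subset min_leaf_treeD in auto)
  let ?S = "(\<lambda>F. potential F r) ` {F. min_leaf_tree F \<and> r \<in> branch_vertices V F}"
  have "Max ?S \<in> ?S" using fin ne by (intro Max_in) auto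
  then obtain F' where F': "min_leaf_tree F'" "r \<in> branch_vertices V F'" "potential F' r = Max ?S" by auto
  have "potential F'' r \<le> Max ?S" if "min_leaf_tree F''" "r \<in> branch_vertices V F''" for F''
    using that fin by (intro Max_ge) auto
  then have "optimal F' r" using F' by (simp add: optimal_def)
  then show ?thesis by blast
qed

lemma spanning_tree_bound:
  assumes con: "connected_graph V Ed" and K: "K14_free V Ed"
    and sig: "sigma V Ed (k + 3) \<ge> enat (card V - k)"
  shows "\<exists>F. stree F \<and> card (leaves V F) + card (branch_vertices V F) \<le> 2 * k + 3"
proof (rule ccontr)
  assume c: "\<not> ?thesis"
  then have big: "2 * k + 4 \<le> card (leaves V F) + card (branch_vertices V F)" if "stree F" for F
    using that by fastforce
  have LV: "card (leaves V F) \<le> card V" "card (branch_vertices V F) \<le> card V" for F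
    using finite_V by (auto intro!: card_mono simp: leaves_def branch_vertices_def)
  obtain F0 where F0: "stree F0" using stree_exists[OF con] by blast
  have V2: "card V \<ge> 2" using big[OF F0] LV[of F0] by simp
  \<comment> \<open>A tree without branch vertices has at most two leaves and would satisfy the
    bound, so a root exists.\<close>
  have "branch_vertices V F \<noteq> {}" if F: "stree F" for F
  proof
    assume B: "branch_vertices V F = {}"
    have "(if v \<in> leaves V F then 1 else 0) + degree F v \<le> 2" if "v \<in> V" for v
      using B that by (auto simp: leaves_def branch_vertices_def not_le)
    then have "(\<Sum>v\<in>V. (if v \<in> leaves V F then 1 else 0) + degree F v) \<le> (\<Sum>v\<in>V. 2)" by (rule sum_mono)
    moreover have "V \<inter> leaves V F = leaves V F" by (auto simp: leaves_def)
    ultimately have "card (leaves V F) + 2 * card F \<le> 2 * card V"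
      using degree_sum_edges[OF stree_subset[OF F]] finite_V
      unfolding sum.distrib by (simp flip: sum.inter_restrict)
    then have "card (leaves V F) \<le> 2" using stree_card[OF F] by simp
    then show False using big[OF F] B by simp
  qed
  then obtain F r where o: "optimal F r" using optimal_exists[OF con] by blast
  note m = optimalD(1)[OF o] and r = optimalD(2)[OF o] and F = optimalD(3)[OF o]
  let ?L = "leaves V F" and ?B = "branch_vertices V F"
  have "k + 3 \<le> card ?L" using big[OF F] branch_leaf_count[OF F V2] by simp
  then obtain S where S: "S \<subseteq> ?L" "card S = k + 3" using obtain_subset_with_card_n by metis
  have "independent_set V Ed S"
    using S(1) leaves_independent[OF m r] by (auto simp: independent_set_def leaves_def)
  then have "sigma V Ed (k + 3) \<le> enat (\<Sum>v\<in>S. degree Ed v)"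
    unfolding sigma_def using S(2) by (intro INF_lower) simp
  then have "card V - k \<le> (\<Sum>v\<in>S. degree Ed v)" using sig by (metis enat_ord_simps(1) order_trans)
  \<comment> \<open>Leaves outside \<open>S\<close> add at least one each. With
    \<open>n = card V\<close> this gives
    \<open>(n - k) + (card ?L - k - 3) \<le> n - card ?B\<close>, which is the bound assumed to
    fail.\<close>
  moreover have "card (?L - S) \<le> (\<Sum>v\<in>?L - S. degree Ed v)"
  proof -
    have "1 \<le> degree Ed v" if "v \<in> ?L" for v
    proof -
      have "degree F v \<le> degree Ed v"
        unfolding degree_def using adj_mono[OF stree_subset[OF F]] finite_nbrs[OF subset_refl]
        by (intro card_mono) auto
      then show ?thesis using that by (simp add: leaves_def)
    qed
    then show ?thesis using sum_mono[of "?L - S" "\<lambda>_. 1" "degree Ed"] by simp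
  qed
  moreover have "(\<Sum>v\<in>?L. degree Ed v) = (\<Sum>v\<in>?L - S. degree Ed v) + (\<Sum>v\<in>S. degree Ed v)"
    using sum.subset_diff[OF S(1) finite_leaves] by simp
  moreover have "card (?L - S) + (k + 3) = card ?L"
    using S finite_leaves by (metis card_Diff_subset card_mono finite_subset le_add_diff_inverse2)
  ultimately show False using degree_sum_leaves[OF K o] big[OF F] by linarith
qed

end

theorem theorem2p2:
  fixes V :: "'a set" and Ed :: "'a set set" and k n :: nat
  assumes "simple_graph V Ed"
    and "connected_graph V Ed"
    and "K14_free V Ed"
    and "card V = n"
    and "sigma V Ed (k + 3) \<ge> enat (n - k)"
  shows "\<exists>T. spanning_tree V Ed T \<and>
             card (leaves V T) + card (branch_vertices V T) \<le> 2 * k + 3"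
proof -
  interpret finite_graph V Ed by unfold_locales (rule assms)
  show ?thesis using spanning_tree_bound assms stree_is_tree by blast
qed

end
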